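(* Let $B$ be a Bol algebra over $\mathbb{K}$, let $V$ be a vector space viewed as a Bol algebra with trivial operations, and let $0\to V\to\widehat{B}\xrightarrow{p}B\to0$ be an abelian split extension of $B$ by $V$, with $\sigma:B\to\widehat{B}$ a section of $p$. For all $x_i\in B$ define $$\nu(x_1,x_2):=\sigma(x_1)*_{\widehat{B}}\sigma(x_2)-\sigma(x_1*x_2),\qquad \omega(x_1,x_2,x_3):=[\sigma(x_1),\sigma(x_2),\sigma(x_3)]_{\widehat{B}}-\sigma([x_1,x_2,x_3]).$$ Then $(\nu,\omega)$ is a $(2,3)$-cocycle of $B$ with coefficients in $V$ with respect to the representation $(\rho,D,\theta)$ of $B$ in $V$ given by $\rho(x)(u):=\sigma(x)*_{\widehat{B}}u$, $D(x_1,x_2)(u):=[\sigma(x_1),\sigma(x_2),u]_{\widehat{B}}$, $\theta(x_1,x_2)(u):=[u,\sigma(x_1),\sigma(x_2)]_{\widehat{B}}$ for $x,x_i\in B$, $u\in V$.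
   Context: All vector spaces and algebras are finite-dimensional over a field $\mathbb{K}$ of characteristic zero. A Bol algebra is a triple $(B,*,[\,,\,,\,])$ with $B$ a vector space, $*$ a bilinear operation and $[\,,\,,\,]$ a trilinear operation on $B$ such that for all $u,v,w,x,y,z\in B$: (B01) $x*y=-y*x$; (B02) $[x,y,z]=-[y,x,z]$; (B1) $[x,y,z]+[y,z,x]+[z,x,y]=0$; (B2) $[x,y,u*v]=[x,y,u]*v+u*[x,y,v]+[u,v,x*y]-(u*v)*(x*y)$; (B3) $[x,y,[u,v,w]]=[[x,y,u],v,w]+[u,[x,y,v],w]+[u,v,[x,y,w]]$. Homomorphisms are linear maps preserving both operations. Extensions: let $B$, $V$, $(\widehat{B},*_{\widehat{B}},[\,,\,,\,]_{\widehat{B}})$ be Bol algebras and $i:V\to\widehat{B}$, $p:\widehat{B}\to B$ homomorphisms. $\widehat{B}$ is an extension of $B$ by $V$ if $0\to V\xrightarrow{i}\widehat{B}\xrightarrow{p}B\to0$ is exact. Identifying $V$ with $i(V)=\ker p$, the extension is abelian if $V$ is an abelian ideal of $\widehat{B}$, i.e. an ideal (any product $*_{\widehat{B}}$ or $[\,,\,,\,]_{\widehat{B}}$ with at least one factor in $V$ lies in $V$) such that $u*_{\widehat{B}}v=0$, $[u,v,\cdot]_{\widehat{B}}=0$, $[u,\cdot,v]_{\widehat{B}}=0$, $[\cdot,u,v]_{\widehat{B}}=0$ for all $u,v\in V$. A section of $p$ is a linear map $\sigma:B\to\widehat{B}$ with $p\circ\sigma=\mathrm{id}_B$, in which case the extension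 is said to be split. A representation of a Bol algebra $B$ in a vector space $V$ is a triple $(\rho,D,\theta)$ with $\rho:B\to\mathrm{End}(V)$ linear and $D,\theta:B\times B\to \mathrm{End}(V)$ bilinear such that for all $x_i,y_i\in B$ (with $[f,g]=fg-gf$ in $\mathrm{End}(V)$): (R1) $D(x_1,x_2)+\theta(x_1,x_2)-\theta(x_2,x_1)=0$; (R21) $[D(x_1,x_2),\rho(y_1)]=\rho([x_1,x_2,y_1])-\theta(y_1,x_1*x_2)+\rho(x_1*x_2)\rho(y_1)$; (R22) $\theta(x_1,y_1*y_2)=\rho(y_1)\theta(x_1,y_2)-\rho(y_2)\theta(x_1,y_1)-\big(D(y_1,y_2)-\rho(y_1*y_2)\big)\rho(x_1)$; (R31) $[D(x_1,x_2),D(y_1,y_2)]=D([x_1,x_2,y_1],y_2)+D(y_1,[x_1,x_2,y_2])$; (R32) $[D(x_1,x_2),\theta(y_1,y_2)]=\theta([x_1,x_2,y_1],y_2)+\theta(y_1,[x_1,x_2,y_2])$; (R33) $\theta(x_1,[y_1,y_2,y_3])=\theta(y_2,y_3)\theta(x_1,y_1)-\theta(y_1,y_3)\theta(x_1,y_2)+D(y_1,y_2)\theta(x_1,y_3)$. $(2,3)$-cocycle of $B$ with coefficients in $(V,\rho,D,\theta)$: a pair $(\nu,\omega)$ with $\nu:B\times B\to V$ bilinear, $\nu(x_1,x_2)=-\nu(x_2,x_1)$, and $\omega:B\times B\times B\to V$ trilinear, $\omega(x_1,x_2,x_3)=-\omega(x_2,x_1,x_3)$, such that for all $x_i,y_i\in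 B$: (CC1) $\omega(x_1,x_2,x_3)+\omega(x_2,x_3,x_1)+\omega(x_3,x_1,x_2)=0$; (CC2) $\omega(x_1,x_2,y_1*y_2)+D(x_1,x_2)\nu(y_1,y_2)=\omega(y_1,y_2,x_1*x_2)+D(y_1,y_2)\nu(x_1,x_2)+\nu([x_1,x_2,y_1],y_2)+\nu(y_1,[x_1,x_2,y_2])+\rho(y_1)\omega(x_1,x_2,y_2)-\rho(y_2)\omega(x_1,x_2,y_1)+\rho(x_1*x_2)\nu(y_1,y_2)-\rho(y_1*y_2)\nu(x_1,x_2)-\nu(y_1*y_2,x_1*x_2)$; (CC3) $\omega(x_1,x_2,[y_1,y_2,y_3])+D(x_1,x_2)\omega(y_1,y_2,y_3)=\omega([x_1,x_2,y_1],y_2,y_3)+\omega(y_1,[x_1,x_2,y_2],y_3)+\omega(y_1,y_2,[x_1,x_2,y_3])+D(y_1,y_2)\omega(x_1,x_2,y_3)+\theta(y_2,y_3)\omega(x_1,x_2,y_1)-\theta(y_1,y_3)\omega(x_1,x_2,y_2)$. *)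

theory Defs
  imports Complex_Main
begin

text \<open>
  A vector space is a whole type of class \<open>ab_group_add\<close> together with a scalar multiplication by
  a field of characteristic zero, in the sense of the locale \<open>vector_space\<close>.
\<close>

definition fin_dim :: "('k::field_char_0 \<Rightarrow> 'v::ab_group_add \<Rightarrow> 'v) \<Rightarrow> bool"
  where "fin_dim s \<longleftrightarrow> (\<exists>Basis. finite_dimensional_vector_space s Basis)"

definition bilinear_map ::
  "('k::field_char_0 \<Rightarrow> 'a::ab_group_add \<Rightarrow> 'a) \<Rightarrow> ('k \<Rightarrow> 'b::ab_group_add \<Rightarrow> 'b) \<Rightarrow>
   ('k \<Rightarrow> 'c::ab_group_add \<Rightarrow> 'c) \<Rightarrow> ('a \<Rightarrow> 'b \<Rightarrow> 'c) \<Rightarrow> bool"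
  where "bilinear_map s1 s2 s f \<longleftrightarrow>
    (\<forall>y. Vector_Spaces.linear s1 s (\<lambda>x. f x y)) \<and>
    (\<forall>x. Vector_Spaces.linear s2 s (\<lambda>y. f x y))"

definition trilinear_map ::
  "('k::field_char_0 \<Rightarrow> 'a::ab_group_add \<Rightarrow> 'a) \<Rightarrow> ('k \<Rightarrow> 'b::ab_group_add \<Rightarrow> 'b) \<Rightarrow>
   ('k \<Rightarrow> 'c::ab_group_add \<Rightarrow> 'c) \<Rightarrow> ('k \<Rightarrow> 'd::ab_group_add \<Rightarrow> 'd) \<Rightarrow>
   ('a \<Rightarrow> 'b \<Rightarrow> 'c \<Rightarrow> 'd) \<Rightarrow> bool"
  where "trilinear_map s1 s2 s3 s f \<longleftrightarrow>
    (\<forall>y z. Vector_Spaces.linear s1 s (\<lambda>x. f x y z)) \<and>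
    (\<forall>x z. Vector_Spaces.linear s2 s (\<lambda>y. f x y z)) \<and>
    (\<forall>x y. Vector_Spaces.linear s3 s (\<lambda>z. f x y z))"

locale bol_algebra =
  fixes scale :: "'k::field_char_0 \<Rightarrow> 'b::ab_group_add \<Rightarrow> 'b"
    and mul :: "'b \<Rightarrow> 'b \<Rightarrow> 'b" (infixl \<open>\<star>\<close> 70)
    and br :: "'b \<Rightarrow> 'b \<Rightarrow> 'b \<Rightarrow> 'b"
  assumes fin_dim: "fin_dim scale"
    and bilinear_mul: "bilinear_map scale scale scale (\<star>)"
    and trilinear_br: "trilinear_map scale scale scale scale br"
    and B01: "x \<star> y = - (y \<star> x)"
    and B02: "br x y z = - br y x z"
    and B1: "br x y z + br y z x + br z x y = 0"
    and B2: "br x y (u \<star> v) =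
      br x y u \<star> v + u \<star> br x y v + br u v (x \<star> y) - (u \<star> v) \<star> (x \<star> y)"
    and B3: "br x y (br u v w) =
      br (br x y u) v w + br u (br x y v) w + br u v (br x y w)"

definition bol_hom ::
  "('k::field_char_0 \<Rightarrow> 'a::ab_group_add \<Rightarrow> 'a) \<Rightarrow> ('a \<Rightarrow> 'a \<Rightarrow> 'a) \<Rightarrow> ('a \<Rightarrow> 'a \<Rightarrow> 'a \<Rightarrow> 'a) \<Rightarrow>
   ('k \<Rightarrow> 'b::ab_group_add \<Rightarrow> 'b) \<Rightarrow> ('b \<Rightarrow> 'b \<Rightarrow> 'b) \<Rightarrow> ('b \<Rightarrow> 'b \<Rightarrow> 'b \<Rightarrow> 'b) \<Rightarrow>
   ('a \<Rightarrow> 'b) \<Rightarrow> bool"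
  where "bol_hom sA mulA brA sB mulB brB f \<longleftrightarrow>
    Vector_Spaces.linear sA sB f \<and>
    (\<forall>x y. f (mulA x y) = mulB (f x) (f y)) \<and>
    (\<forall>x y z. f (brA x y z) = brB (f x) (f y) (f z))"

context bol_algebra
begin

definition bol_ideal :: "'b set \<Rightarrow> bool"
  where "bol_ideal I \<longleftrightarrow> module.subspace scale I \<and>
    (\<forall>u\<in>I. \<forall>x. u \<star> x \<in> I \<and> x \<star> u \<in> I) \<and>
    (\<forall>u\<in>I. \<forall>x y. br u x y \<in> I \<and> br x u y \<in> I \<and> br x y u \<in> I)"

definition abelian_ideal :: "'b set \<Rightarrow> bool"
  where "abelian_ideal I \<longleftrightarrow> bol_ideal I \<and>
    (\<forall>u\<in>I. \<forall>v\<in>I. u \<star> v = 0 \<and> (\<forall>x. br u v x = 0 \<and> br u x v = 0 \<and> br x u v = 0))"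

end

locale bol_extension =
  B: bol_algebra sB mulB brB + V: bol_algebra sV mulV brV + E: bol_algebra sE mulE brE
  for sB :: "'k::field_char_0 \<Rightarrow> 'b::ab_group_add \<Rightarrow> 'b" and mulB brB
    and sV :: "'k \<Rightarrow> 'v::ab_group_add \<Rightarrow> 'v" and mulV brV
    and sE :: "'k \<Rightarrow> 'e::ab_group_add \<Rightarrow> 'e" and mulE brE +
  fixes i :: "'v \<Rightarrow> 'e" and p :: "'e \<Rightarrow> 'b"
  assumes hom_i: "bol_hom sV mulV brV sE mulE brE i"
    and hom_p: "bol_hom sE mulE brE sB mulB brB p"
    and inj_i: "inj i"
    and exact: "range i = {e. p e = 0}"
    and surj_p: "surj p"

locale abelian_bol_extension = bol_extension +
  assumes abelian: "E.abelian_ideal (range i)"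

definition linear_section ::
  "('k::field_char_0 \<Rightarrow> 'b::ab_group_add \<Rightarrow> 'b) \<Rightarrow> ('k \<Rightarrow> 'e::ab_group_add \<Rightarrow> 'e) \<Rightarrow>
   ('e \<Rightarrow> 'b) \<Rightarrow> ('b \<Rightarrow> 'e) \<Rightarrow> bool"
  where "linear_section sB sE p \<sigma> \<longleftrightarrow> Vector_Spaces.linear sB sE \<sigma> \<and> p \<circ> \<sigma> = id"

definition commutator :: "('v::ab_group_add \<Rightarrow> 'v) \<Rightarrow> ('v \<Rightarrow> 'v) \<Rightarrow> 'v \<Rightarrow> 'v"
  where "commutator f g = (\<lambda>u. f (g u) - g (f u))"

text \<open>
  Maps into \<open>End(V)\<close> are curried: bilinearity of \<open>\<rho>\<close> (trilinearity of \<open>D\<close> and \<open>\<theta>\<close>) says both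
  that the values are endomorphisms and that they depend linearly (bilinearly) on the arguments
  from \<open>B\<close>. Identities in \<open>End(V)\<close> are written out at an arbitrary \<open>u\<close>.
\<close>

locale bol_representation = bol_algebra sB mul br
  for sB :: "'k::field_char_0 \<Rightarrow> 'b::ab_group_add \<Rightarrow> 'b"
    and mul (infixl \<open>\<star>\<close> 70) and br +
  fixes sV :: "'k \<Rightarrow> 'v::ab_group_add \<Rightarrow> 'v"
    and \<rho> :: "'b \<Rightarrow> 'v \<Rightarrow> 'v"
    and D \<theta> :: "'b \<Rightarrow> 'b \<Rightarrow> 'v \<Rightarrow> 'v"
  assumes fin_dim_V: "fin_dim sV"
    and linear_\<rho>: "bilinear_map sB sV sV \<rho>"
    and bilinear_D: "trilinear_map sB sB sV sV D"
    and bilinear_\<theta>: "trilinear_map sB sB sV sV \<theta>"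
    and R1: "D x1 x2 u + \<theta> x1 x2 u - \<theta> x2 x1 u = 0"
    and R21: "commutator (D x1 x2) (\<rho> y1) u =
      \<rho> (br x1 x2 y1) u - \<theta> y1 (x1 \<star> x2) u + \<rho> (x1 \<star> x2) (\<rho> y1 u)"
    and R22: "\<theta> x1 (y1 \<star> y2) u =
      \<rho> y1 (\<theta> x1 y2 u) - \<rho> y2 (\<theta> x1 y1 u) - (D y1 y2 (\<rho> x1 u) - \<rho> (y1 \<star> y2) (\<rho> x1 u))"
    and R31: "commutator (D x1 x2) (D y1 y2) u = D (br x1 x2 y1) y2 u + D y1 (br x1 x2 y2) u"
    and R32: "commutator (D x1 x2) (\<theta> y1 y2) u = \<theta> (br x1 x2 y1) y2 u + \<theta> y1 (br x1 x2 y2) u"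
    and R33: "\<theta> x1 (br y1 y2 y3) u =
      \<theta> y2 y3 (\<theta> x1 y1 u) - \<theta> y1 y3 (\<theta> x1 y2 u) + D y1 y2 (\<theta> x1 y3 u)"

locale bol_cocycle = bol_representation sB mul br sV \<rho> D \<theta>
  for sB :: "'k::field_char_0 \<Rightarrow> 'b::ab_group_add \<Rightarrow> 'b"
    and mul (infixl \<open>\<star>\<close> 70) and br
    and sV :: "'k \<Rightarrow> 'v::ab_group_add \<Rightarrow> 'v" and \<rho> D \<theta> +
  fixes \<nu> :: "'b \<Rightarrow> 'b \<Rightarrow> 'v"
    and \<omega> :: "'b \<Rightarrow> 'b \<Rightarrow> 'b \<Rightarrow> 'v"
  assumes bilinear_\<nu>: "bilinear_map sB sB sV \<nu>"
    and skew_\<nu>: "\<nu> x1 x2 = - \<nu> x2 x1"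
    and trilinear_\<omega>: "trilinear_map sB sB sB sV \<omega>"
    and skew_\<omega>: "\<omega> x1 x2 x3 = - \<omega> x2 x1 x3"
    and CC1: "\<omega> x1 x2 x3 + \<omega> x2 x3 x1 + \<omega> x3 x1 x2 = 0"
    and CC2: "\<omega> x1 x2 (y1 \<star> y2) + D x1 x2 (\<nu> y1 y2) =
      \<omega> y1 y2 (x1 \<star> x2) + D y1 y2 (\<nu> x1 x2)
      + \<nu> (br x1 x2 y1) y2 + \<nu> y1 (br x1 x2 y2)
      + \<rho> y1 (\<omega> x1 x2 y2) - \<rho> y2 (\<omega> x1 x2 y1)
      + \<rho> (x1 \<star> x2) (\<nu> y1 y2) - \<rho> (y1 \<star> y2) (\<nu> x1 x2)
      - \<nu> (y1 \<star> y2) (x1 \<star> x2)"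
    and CC3: "\<omega> x1 x2 (br y1 y2 y3) + D x1 x2 (\<omega> y1 y2 y3) =
      \<omega> (br x1 x2 y1) y2 y3 + \<omega> y1 (br x1 x2 y2) y3 + \<omega> y1 y2 (br x1 x2 y3)
      + D y1 y2 (\<omega> x1 x2 y3) + \<theta> y2 y3 (\<omega> x1 x2 y1) - \<theta> y1 y3 (\<omega> x1 x2 y2)"

end

theory Submission
  imports Defs
begin

text \<open>
  Every element of $\widehat B$ is uniquely $\sigma(x) + i(u)$, and in these coordinates the two
  operations are those of $B$ on the $\sigma$-part, corrected by $\nu$, $\omega$, $\rho$, $D$, $\theta$
  on the $i$-part, all products with two factors in $V$ being zero. Expanding the Bol identities of
  $\widehat B$ at arguments $\sigma(x)$ and comparing the $i$-parts yields the cocycle conditions;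
  putting one argument in $V$ yields the axioms of a representation.
\<close>

section \<open>Linear maps and their descent along an injection\<close>

lemma linear_iff_add_scale:
  assumes "fin_dim s1" and "fin_dim s2"
  shows "Vector_Spaces.linear s1 s2 f \<longleftrightarrow>
    (\<forall>x y. f (x + y) = f x + f y) \<and> (\<forall>c x. f (s1 c x) = s2 c (f x))"
  using assms
  by (auto simp: fin_dim_def Vector_Spaces.linear_iff finite_dimensional_vector_space_def)

text \<open>Injectivity cancels \<open>i\<close> from additivity and homogeneity of
  \<open>\<lambda>x. i (f x)\<close>. This gives linearity of the maps defined through
  \<open>inv i\<close>, which is itself uncontrolled off \<open>range i\<close>.\<close>

lemma linear_descends_inj:
  assumes "fin_dim s1" and "fin_dim s2" and "Vector_Spaces.linear s2 s3 i" and "inj i"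
    and "Vector_Spaces.linear s1 s3 (\<lambda>x. i (f x))"
  shows "Vector_Spaces.linear s1 s2 f"
  using assms(3-5) unfolding linear_iff_add_scale[OF assms(1,2)] Vector_Spaces.linear_iff
  by (metis injD)

lemma linear_diff_map:
  assumes "Vector_Spaces.linear s1 s2 f" and "Vector_Spaces.linear s1 s2 g"
  shows "Vector_Spaces.linear s1 s2 (\<lambda>x. f x - g x)"
proof -
  interpret vector_space_pair s1 s2
    using assms(1) by (simp add: Vector_Spaces.linear_iff vector_space_pair_def)
  show ?thesis using assms by (rule linear_compose_sub)
qed

lemma linear_compose_map:
  assumes "Vector_Spaces.linear s2 s3 g" and "Vector_Spaces.linear s1 s2 f"
  shows "Vector_Spaces.linear s1 s3 (\<lambda>x. g (f x))"
  using Vector_Spaces.linear_compose[OF assms(2,1)] by (simp add: o_def)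

lemma linear_map_add: "Vector_Spaces.linear s1 s2 f \<Longrightarrow> f (x + y) = f x + f y"
  by (simp add: Vector_Spaces.linear_iff)

lemma linear_map_minus: "Vector_Spaces.linear s1 s2 f \<Longrightarrow> f (- x) = - f x"
  by (rule additive.minus) (simp add: additive_def Vector_Spaces.linear_iff)

lemma linear_map_diff: "Vector_Spaces.linear s1 s2 f \<Longrightarrow> f (x - y) = f x - f y"
  by (rule additive.diff) (simp add: additive_def Vector_Spaces.linear_iff)

section \<open>Multilinearity of the operations of a Bol algebra\<close>

context bol_algebra
begin

lemma linear_mul:
  "Vector_Spaces.linear scale scale (\<lambda>x. x \<star> y)" "Vector_Spaces.linear scale scale (\<lambda>y. x \<star> y)"
  using bilinear_mul by (auto simp: bilinear_map_def)

lemma linear_br: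
  "Vector_Spaces.linear scale scale (\<lambda>x. br x y z)"
  "Vector_Spaces.linear scale scale (\<lambda>y. br x y z)"
  "Vector_Spaces.linear scale scale (\<lambda>z. br x y z)"
  using trilinear_br by (auto simp: trilinear_map_def)

lemmas mul_add = linear_mul[THEN linear_map_add]
lemmas br_add = linear_br[THEN linear_map_add]
lemmas mul_minus = linear_mul[THEN linear_map_minus]
lemmas br_minus = linear_br[THEN linear_map_minus]

end

section \<open>The split extension in coordinates\<close>

locale split_abelian_extension =
  abelian_bol_extension sB mulB brB sV mulV brV sE mulE brE i p
  for sB :: "'k::field_char_0 \<Rightarrow> 'b::ab_group_add \<Rightarrow> 'b" and mulB brB
    and sV :: "'k \<Rightarrow> 'v::ab_group_add \<Rightarrow> 'v" and mulV brV
    and sE :: "'k \<Rightarrow> 'e::ab_group_add \<Rightarrow> 'e" and mulE brE i p +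
  fixes \<sigma> :: "'b \<Rightarrow> 'e"
  assumes section_\<sigma>: "linear_section sB sE p \<sigma>"
begin

text \<open>In this and the next four definitions \<open>inv i\<close> realizes the identification
  of \<open>V\<close> with \<open>range i\<close>. It is meaningful only once its argument is known
  to lie there, which \<open>i_\<nu>\<close> to \<open>i_\<theta>\<close> establish.\<close>

definition \<nu> :: "'b \<Rightarrow> 'b \<Rightarrow> 'v"
  where "\<nu> x1 x2 = inv i (mulE (\<sigma> x1) (\<sigma> x2) - \<sigma> (mulB x1 x2))"

definition \<omega> :: "'b \<Rightarrow> 'b \<Rightarrow> 'b \<Rightarrow> 'v"
  where "\<omega> x1 x2 x3 = inv i (brE (\<sigma> x1) (\<sigma> x2) (\<sigma> x3) - \<sigma> (brB x1 x2 x3))"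

definition \<rho> :: "'b \<Rightarrow> 'v \<Rightarrow> 'v"
  where "\<rho> x u = inv i (mulE (\<sigma> x) (i u))"

definition D :: "'b \<Rightarrow> 'b \<Rightarrow> 'v \<Rightarrow> 'v"
  where "D x1 x2 u = inv i (brE (\<sigma> x1) (\<sigma> x2) (i u))"

definition \<theta> :: "'b \<Rightarrow> 'b \<Rightarrow> 'v \<Rightarrow> 'v"
  where "\<theta> x1 x2 u = inv i (brE (i u) (\<sigma> x1) (\<sigma> x2))"

lemma linear_i: "Vector_Spaces.linear sV sE i"
  using hom_i by (simp add: bol_hom_def)

lemma linear_\<sigma>: "Vector_Spaces.linear sB sE \<sigma>"
  using section_\<sigma> by (simp add: linear_section_def)

lemma p_\<sigma>: "p (\<sigma> x) = x"
  using section_\<sigma> by (simp add: linear_section_def fun_eq_iff)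

lemmas i_add = linear_map_add[OF linear_i]
lemmas i_minus = linear_map_minus[OF linear_i]
lemmas i_diff = linear_map_diff[OF linear_i]
lemmas \<sigma>_add = linear_map_add[OF linear_\<sigma>]
lemmas \<sigma>_minus = linear_map_minus[OF linear_\<sigma>]
lemmas \<sigma>_diff = linear_map_diff[OF linear_\<sigma>]

lemma i_0: "i 0 = 0"
  using i_add[of 0 0] by simp

lemma i_inv_ideal: "e \<in> range i \<Longrightarrow> i (inv i e) = e"
  by (rule f_inv_into_f)

lemma i_inv_kernel: "p e = 0 \<Longrightarrow> i (inv i e) = e"
  using exact by (auto intro: i_inv_ideal)

lemma p_diff: "p (x - y) = p x - p y"
  using hom_p by (auto simp: bol_hom_def intro: linear_map_diff)

lemma p_mul: "p (mulE x y) = mulB (p x) (p y)"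
  using hom_p by (simp add: bol_hom_def)

lemma p_br: "p (brE x y z) = brB (p x) (p y) (p z)"
  using hom_p by (simp add: bol_hom_def)

lemma ideal:
  "mulE x (i u) \<in> range i" "brE (i u) x y \<in> range i" "brE x y (i u) \<in> range i"
  using abelian by (auto simp: E.abelian_ideal_def E.bol_ideal_def)

lemma abelian_products:
  "mulE (i u) (i v) = 0" "brE (i u) (i v) x = 0" "brE (i u) x (i v) = 0" "brE x (i u) (i v) = 0"
  using abelian by (auto simp: E.abelian_ideal_def)

text \<open>Since \<open>p\<close> is a homomorphism with \<open>p (\<sigma> x) = x\<close>, it
  kills the difference, and exactness puts the kernel of \<open>p\<close> in \<open>range i\<close>.
  The same holds for \<open>\<omega>\<close>; for \<open>\<rho>\<close>, \<open>D\<close> and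
  \<open>\<theta>\<close> the ideal property suffices.\<close>

lemma i_\<nu>: "i (\<nu> x1 x2) = mulE (\<sigma> x1) (\<sigma> x2) - \<sigma> (mulB x1 x2)"
  unfolding \<nu>_def by (rule i_inv_kernel) (simp add: p_diff p_mul p_\<sigma>)

lemma i_\<omega>: "i (\<omega> x1 x2 x3) = brE (\<sigma> x1) (\<sigma> x2) (\<sigma> x3) - \<sigma> (brB x1 x2 x3)"
  unfolding \<omega>_def by (rule i_inv_kernel) (simp add: p_diff p_br p_\<sigma>)

lemma i_\<rho>: "i (\<rho> x u) = mulE (\<sigma> x) (i u)"
  unfolding \<rho>_def by (rule i_inv_ideal) (rule ideal)

lemma i_D: "i (D x1 x2 u) = brE (\<sigma> x1) (\<sigma> x2) (i u)"
  unfolding D_def by (rule i_inv_ideal) (rule ideal)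

lemma i_\<theta>: "i (\<theta> x1 x2 u) = brE (i u) (\<sigma> x1) (\<sigma> x2)"
  unfolding \<theta>_def by (rule i_inv_ideal) (rule ideal)

text \<open>Together with \<open>abelian_products\<close> this is the multiplication table of the
  extension. Skew symmetry reduces \<open>\<sigma>\<close> and \<open>i\<close> in the other order
  to \<open>\<rho>\<close> and \<open>\<theta>\<close>; the last bracket slot needs the separate map
  \<open>D\<close>.\<close>

lemma split_products:
  "mulE (\<sigma> x) (\<sigma> y) = \<sigma> (mulB x y) + i (\<nu> x y)"
  "mulE (\<sigma> x) (i u) = i (\<rho> x u)"
  "mulE (i u) (\<sigma> x) = - i (\<rho> x u)"
  "brE (\<sigma> x) (\<sigma> y) (\<sigma> z) = \<sigma> (brB x y z) + i (\<omega> x y z)"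
  "brE (\<sigma> x) (\<sigma> y) (i u) = i (D x y u)"
  "brE (i u) (\<sigma> x) (\<sigma> y) = i (\<theta> x y u)"
  "brE (\<sigma> x) (i u) (\<sigma> y) = - i (\<theta> x y u)"
  using E.B01[of "i u" "\<sigma> x"] E.B02[of "\<sigma> x" "i u" "\<sigma> y"]
  by (simp_all add: i_\<nu> i_\<omega> i_\<rho> i_D i_\<theta>)

lemmas expand = split_products abelian_products E.mul_add E.br_add E.mul_minus E.br_minus

lemma i_eqI: "i u = i v \<Longrightarrow> u = v"
  using inj_i by (rule injD)

lemma linear_descends_i:
  "Vector_Spaces.linear sB sE (\<lambda>x. i (f x)) \<Longrightarrow> Vector_Spaces.linear sB sV f"
  "Vector_Spaces.linear sV sE (\<lambda>x. i (g x)) \<Longrightarrow> Vector_Spaces.linear sV sV g"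
  using linear_descends_inj[OF _ _ linear_i inj_i] B.fin_dim V.fin_dim by blast+

text \<open>Once \<open>i\<close> is applied and its image rewritten, each map is built in one
  variable from \<open>\<sigma>\<close>, \<open>i\<close>, the operations and a difference; these
  rules follow that structure.\<close>

lemmas linear_intros = linear_diff_map
  linear_compose_map[OF E.linear_mul(1)] linear_compose_map[OF E.linear_mul(2)]
  linear_compose_map[OF E.linear_br(1)] linear_compose_map[OF E.linear_br(2)]
  linear_compose_map[OF E.linear_br(3)]
  linear_\<sigma> linear_i linear_compose_map[OF linear_\<sigma>] B.linear_mul B.linear_br

section \<open>The representation axioms\<close>

lemma representation: "bol_representation sB mulB brB sV \<rho> D \<theta>"
proof unfold_locales
  show "fin_dim sV" by (rule V.fin_dim)
  show "bilinear_map sB sV sV \<rho>" unfolding bilinear_map_def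
    by (intro conjI allI; rule linear_descends_i; simp only: i_\<rho>; intro linear_intros)
  show "trilinear_map sB sB sV sV D" unfolding trilinear_map_def
    by (intro conjI allI; rule linear_descends_i; simp only: i_D; intro linear_intros)
  show "trilinear_map sB sB sV sV \<theta>" unfolding trilinear_map_def
    by (intro conjI allI; rule linear_descends_i; simp only: i_\<theta>; intro linear_intros)
  fix x1 x2 y1 y2 y3 :: 'b and u :: 'v
  \<comment> \<open>The right side is the cyclic sum of \<open>B1\<close> at
    \<open>\<sigma> x1\<close>, \<open>\<sigma> x2\<close>, \<open>i u\<close>; its middle term
    contributes \<open>- \<theta> x2 x1 u\<close>.\<close>
  have "i (D x1 x2 u + \<theta> x1 x2 u - \<theta> x2 x1 u) =
      brE (\<sigma> x1) (\<sigma> x2) (i u) + brE (\<sigma> x2) (i u) (\<sigma> x1) + brE (i u) (\<sigma> x1) (\<sigma> x2)"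
    by (simp add: expand i_add i_diff)
  then show "D x1 x2 u + \<theta> x1 x2 u - \<theta> x2 x1 u = 0"
    by (intro i_eqI) (simp add: E.B1 i_0)
  \<comment> \<open>Here and below, the corrections by \<open>\<nu>\<close> and
    \<open>\<omega>\<close> meet another element of \<open>V\<close> in every product and vanish, so
    only the operations of \<open>B\<close> enter the axioms. The slot of \<open>i u\<close> selects
    the axiom: in \<open>B2\<close>, last for this one and first for the next.\<close>
  show "commutator (D x1 x2) (\<rho> y1) u =
      \<rho> (brB x1 x2 y1) u - \<theta> y1 (mulB x1 x2) u + \<rho> (mulB x1 x2) (\<rho> y1 u)"
    using E.B2[of "\<sigma> x1" "\<sigma> x2" "\<sigma> y1" "i u"]
    by (intro i_eqI) (simp add: commutator_def expand i_add i_diff algebra_simps)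
  show "\<theta> x1 (mulB y1 y2) u =
      \<rho> y1 (\<theta> x1 y2 u) - \<rho> y2 (\<theta> x1 y1 u)
      - (D y1 y2 (\<rho> x1 u) - \<rho> (mulB y1 y2) (\<rho> x1 u))"
    using E.B2[of "i u" "\<sigma> x1" "\<sigma> y1" "\<sigma> y2"]
    by (intro i_eqI) (simp add: expand i_add i_diff algebra_simps)
  \<comment> \<open>The three remaining axioms are \<open>B3\<close> with \<open>i u\<close> in the
    last, third and first slot.\<close>
  show "commutator (D x1 x2) (D y1 y2) u = D (brB x1 x2 y1) y2 u + D y1 (brB x1 x2 y2) u"
    using E.B3[of "\<sigma> x1" "\<sigma> x2" "\<sigma> y1" "\<sigma> y2" "i u"]
    by (intro i_eqI) (simp add: commutator_def expand i_add i_diff algebra_simps)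
  show "commutator (D x1 x2) (\<theta> y1 y2) u = \<theta> (brB x1 x2 y1) y2 u + \<theta> y1 (brB x1 x2 y2) u"
    using E.B3[of "\<sigma> x1" "\<sigma> x2" "i u" "\<sigma> y1" "\<sigma> y2"]
    by (intro i_eqI) (simp add: commutator_def expand i_add i_diff algebra_simps)
  show "\<theta> x1 (brB y1 y2 y3) u =
      \<theta> y2 y3 (\<theta> x1 y1 u) - \<theta> y1 y3 (\<theta> x1 y2 u) + D y1 y2 (\<theta> x1 y3 u)"
    using E.B3[of "i u" "\<sigma> x1" "\<sigma> y1" "\<sigma> y2" "\<sigma> y3"]
    by (intro i_eqI) (simp add: expand i_add i_diff algebra_simps)
qed

section \<open>The cocycle conditions\<close>

lemma cocycle: "bol_cocycle sB mulB brB sV \<rho> D \<theta> \<nu> \<omega>"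
proof -
  interpret R: bol_representation sB mulB brB sV \<rho> D \<theta>
    by (rule representation)
  show ?thesis
  proof unfold_locales
    show "bilinear_map sB sB sV \<nu>" unfolding bilinear_map_def
      by (intro conjI allI; rule linear_descends_i; simp only: i_\<nu>; intro linear_intros)
    show "trilinear_map sB sB sB sV \<omega>" unfolding trilinear_map_def
      by (intro conjI allI; rule linear_descends_i; simp only: i_\<omega>; intro linear_intros)
    fix x1 x2 x3 y1 y2 y3 :: 'b
    show "\<nu> x1 x2 = - \<nu> x2 x1"
      using E.B01[of "\<sigma> x1" "\<sigma> x2"] B.B01[of x1 x2]
      by (intro i_eqI) (simp add: i_\<nu> i_minus \<sigma>_minus)
    show "\<omega> x1 x2 x3 = - \<omega> x2 x1 x3"
      using E.B02[of "\<sigma> x1" "\<sigma> x2" "\<sigma> x3"] B.B02[of x1 x2 x3]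
      by (intro i_eqI) (simp add: i_\<omega> i_minus \<sigma>_minus)
    have "i (\<omega> x1 x2 x3 + \<omega> x2 x3 x1 + \<omega> x3 x1 x2) =
        (brE (\<sigma> x1) (\<sigma> x2) (\<sigma> x3) + brE (\<sigma> x2) (\<sigma> x3) (\<sigma> x1) + brE (\<sigma> x3) (\<sigma> x1) (\<sigma> x2))
        - \<sigma> (brB x1 x2 x3 + brB x2 x3 x1 + brB x3 x1 x2)"
      by (simp add: i_\<omega> i_add \<sigma>_add)
    also have "\<dots> = i 0"
      \<comment> \<open>Both cyclic sums vanish by \<open>B1\<close>, and this instance of
        additivity yields \<open>\<sigma> 0 = 0\<close>.\<close>
      using \<sigma>_add[of 0 0] by (simp add: E.B1 B.B1 i_0)
    finally show "\<omega> x1 x2 x3 + \<omega> x2 x3 x1 + \<omega> x3 x1 x2 = 0"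
      by (rule i_eqI)
    \<comment> \<open>\<open>\<sigma>\<close> applied to \<open>B2\<close> in \<open>B\<close>
      cancels the \<open>\<sigma>\<close>-parts of \<open>B2\<close> in the extension. The last
      product there expands into the two \<open>\<rho>\<close>-terms in \<open>\<nu>\<close> and the
      final \<open>\<nu>\<close>-term.\<close>
    show "\<omega> x1 x2 (mulB y1 y2) + D x1 x2 (\<nu> y1 y2) =
        \<omega> y1 y2 (mulB x1 x2) + D y1 y2 (\<nu> x1 x2)
        + \<nu> (brB x1 x2 y1) y2 + \<nu> y1 (brB x1 x2 y2)
        + \<rho> y1 (\<omega> x1 x2 y2) - \<rho> y2 (\<omega> x1 x2 y1)
        + \<rho> (mulB x1 x2) (\<nu> y1 y2) - \<rho> (mulB y1 y2) (\<nu> x1 x2)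
        - \<nu> (mulB y1 y2) (mulB x1 x2)"
      using E.B2[of "\<sigma> x1" "\<sigma> x2" "\<sigma> y1" "\<sigma> y2"] arg_cong[OF B.B2[of x1 x2 y1 y2], of \<sigma>]
      by (intro i_eqI) (simp add: expand i_add i_diff \<sigma>_add \<sigma>_diff algebra_simps)
    \<comment> \<open>The same cancellation with \<open>B3\<close>. On its right side the inner
      correction sits in the first, second or third slot and is acted on by \<open>\<theta>\<close>,
      \<open>- \<theta>\<close> or \<open>D\<close>.\<close>
    show "\<omega> x1 x2 (brB y1 y2 y3) + D x1 x2 (\<omega> y1 y2 y3) =
        \<omega> (brB x1 x2 y1) y2 y3 + \<omega> y1 (brB x1 x2 y2) y3 + \<omega> y1 y2 (brB x1 x2 y3)
        + D y1 y2 (\<omega> x1 x2 y3) + \<theta> y2 y3 (\<omega> x1 x2 y1) - \<theta> y1 y3 (\<omega> x1 x2 y2)"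
      using E.B3[of "\<sigma> x1" "\<sigma> x2" "\<sigma> y1" "\<sigma> y2" "\<sigma> y3"]
        arg_cong[OF B.B3[of x1 x2 y1 y2 y3], of \<sigma>]
      by (intro i_eqI) (simp add: expand i_add i_diff \<sigma>_add \<sigma>_diff algebra_simps)
  qed
qed

end

theorem proposition4p4:
  fixes sB :: "'k::field_char_0 \<Rightarrow> 'b::ab_group_add \<Rightarrow> 'b"
    and mulB :: "'b \<Rightarrow> 'b \<Rightarrow> 'b" and brB :: "'b \<Rightarrow> 'b \<Rightarrow> 'b \<Rightarrow> 'b"
    and sV :: "'k \<Rightarrow> 'v::ab_group_add \<Rightarrow> 'v"
    and sE :: "'k \<Rightarrow> 'e::ab_group_add \<Rightarrow> 'e"
    and mulE :: "'e \<Rightarrow> 'e \<Rightarrow> 'e" and brE :: "'e \<Rightarrow> 'e \<Rightarrow> 'e \<Rightarrow> 'e"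
    and i :: "'v \<Rightarrow> 'e" and p :: "'e \<Rightarrow> 'b" and \<sigma> :: "'b \<Rightarrow> 'e"
    and \<nu> :: "'b \<Rightarrow> 'b \<Rightarrow> 'v" and \<omega> :: "'b \<Rightarrow> 'b \<Rightarrow> 'b \<Rightarrow> 'v"
    and \<rho> :: "'b \<Rightarrow> 'v \<Rightarrow> 'v" and D \<theta> :: "'b \<Rightarrow> 'b \<Rightarrow> 'v \<Rightarrow> 'v"
  assumes ext: "abelian_bol_extension sB mulB brB sV (\<lambda>_ _. 0) (\<lambda>_ _ _. 0) sE mulE brE i p"
    and section_\<sigma>: "linear_section sB sE p \<sigma>"
    and \<nu>: "\<And>x1 x2. \<nu> x1 x2 = inv i (mulE (\<sigma> x1) (\<sigma> x2) - \<sigma> (mulB x1 x2))"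
    and \<omega>: "\<And>x1 x2 x3. \<omega> x1 x2 x3 = inv i (brE (\<sigma> x1) (\<sigma> x2) (\<sigma> x3) - \<sigma> (brB x1 x2 x3))"
    and \<rho>: "\<And>x u. \<rho> x u = inv i (mulE (\<sigma> x) (i u))"
    and D: "\<And>x1 x2 u. D x1 x2 u = inv i (brE (\<sigma> x1) (\<sigma> x2) (i u))"
    and \<theta>: "\<And>x1 x2 u. \<theta> x1 x2 u = inv i (brE (i u) (\<sigma> x1) (\<sigma> x2))"
  shows "(\<forall>x1 x2. i (\<nu> x1 x2) = mulE (\<sigma> x1) (\<sigma> x2) - \<sigma> (mulB x1 x2)) \<and>
    (\<forall>x1 x2 x3. i (\<omega> x1 x2 x3) = brE (\<sigma> x1) (\<sigma> x2) (\<sigma> x3) - \<sigma> (brB x1 x2 x3)) \<and>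
    (\<forall>x u. i (\<rho> x u) = mulE (\<sigma> x) (i u)) \<and>
    (\<forall>x1 x2 u. i (D x1 x2 u) = brE (\<sigma> x1) (\<sigma> x2) (i u)) \<and>
    (\<forall>x1 x2 u. i (\<theta> x1 x2 u) = brE (i u) (\<sigma> x1) (\<sigma> x2)) \<and>
    bol_representation sB mulB brB sV \<rho> D \<theta> \<and>
    bol_cocycle sB mulB brB sV \<rho> D \<theta> \<nu> \<omega>"
proof -
  interpret S: split_abelian_extension
    sB mulB brB sV "\<lambda>_ _. 0" "\<lambda>_ _ _. 0" sE mulE brE i p \<sigma>
    using ext section_\<sigma>
    by (simp add: split_abelian_extension_def split_abelian_extension_axioms_def)
  \<comment> \<open>The hypotheses fix the five maps pointwise by the formulas of the locale, so
    they equal its constants as functions.\<close>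
  have eqs: "\<nu> = S.\<nu>" "\<omega> = S.\<omega>" "\<rho> = S.\<rho>" "D = S.D" "\<theta> = S.\<theta>"
    by (simp_all add: fun_eq_iff \<nu> \<omega> \<rho> D \<theta> S.\<nu>_def S.\<omega>_def S.\<rho>_def S.D_def S.\<theta>_def)
  show ?thesis
    unfolding eqs using S.representation S.cocycle by (simp add: S.i_\<nu> S.i_\<omega> S.i_\<rho> S.i_D S.i_\<theta>)
qed

end
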